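(* Let $k \in \mathbb{Z}_{\ge 0}$, let $n \in \mathbb{Z}_{\ge 1}$, and let $b_n \in \{0,1,2\}$ with $n \equiv b_n \pmod 3$. If $n > 24k + 12 - 8b_n$, then every set $A$ with $|A| = d_n - k$ that works for $n$ is strongly $n$-bounded, i.e., satisfies $A \subset (n/4, n/2)$.
   Context: A numerical semigroup is a subset of $\mathbb{Z}_{\ge 0}$ containing $0$ and closed under addition; $\langle A\rangle$ denotes the numerical semigroup generated by $A$. A set $A \subset \mathbb{Z}_{\ge 1}$ works for $n$ if (i) $n \notin \langle A \rangle$, (ii) $x < n/2$ for all $x \in A$, and (iii) $A$ minimally generates a numerical semigroup, i.e., $\langle A \setminus \{x\}\rangle \neq \langle A \rangle$ for every $x \in A$. Here $d_n = |(n/3, n/2) \cap \mathbb{Z}| = \lfloor (n-1)/2 \rfloor - \lfloor n/3 \rfloor$. *)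

theory Defs
  imports "HOL-Number_Theory.Cong" Complex_Main
begin

text \<open>A numerical semigroup is any additive submonoid of the natural numbers; its complement is
  not required to be finite.\<close>

definition numerical_semigroup :: "nat set \<Rightarrow> bool" where
  "numerical_semigroup S \<longleftrightarrow> 0 \<in> S \<and> (\<forall>x\<in>S. \<forall>y\<in>S. x + y \<in> S)"

definition generated :: "nat set \<Rightarrow> nat set" where
  "generated A = numerical_semigroup hull A"

lemma numerical_semigroup_generated: "numerical_semigroup (generated A)"
  unfolding generated_def by (rule hull_in) (auto simp: numerical_semigroup_def)

definition works_for :: "nat set \<Rightarrow> nat \<Rightarrow> bool" where
  "works_for A n \<longleftrightarrow>
     A \<subseteq> {1..} \<and>
     n \<notin> generated A \<and>
     (\<forall>x\<in>A. real x < real n / 2) \<and>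
     (\<forall>x\<in>A. generated (A - {x}) \<noteq> generated A)"

definition d :: "nat \<Rightarrow> nat" where
  "d n = card {m :: int. real n / 3 < real_of_int m \<and> real_of_int m < real n / 2}"

lemma d_eq_floor: "int (d n) = \<lfloor>(real n - 1) / 2\<rfloor> - \<lfloor>real n / 3\<rfloor>" if "n \<ge> 1"
proof -
  have "real_of_int m < real n / 2 \<longleftrightarrow> m \<le> \<lfloor>(real n - 1) / 2\<rfloor>" for m :: int
  proof -
    have "real_of_int m < real n / 2 \<longleftrightarrow> real_of_int (2 * m) < real_of_int (int n)"
      by (simp add: mult.commute)
    also have "\<dots> \<longleftrightarrow> 2 * m + 1 \<le> int n"
      by (simp only: of_int_less_iff) linarith
    also have "\<dots> \<longleftrightarrow> real_of_int (2 * m + 1) \<le> real_of_int (int n)"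
      by (simp only: of_int_le_iff)
    also have "\<dots> \<longleftrightarrow> m \<le> \<lfloor>(real n - 1) / 2\<rfloor>"
      by (simp add: le_floor_iff field_simps)
    finally show ?thesis .
  qed
  then have "{m :: int. real n / 3 < real_of_int m \<and> real_of_int m < real n / 2} =
      {\<lfloor>real n / 3\<rfloor> <.. \<lfloor>(real n - 1) / 2\<rfloor>}"
    by (simp only: floor_less_iff greaterThanAtMost_def greaterThan_def atMost_def Int_def mem_Collect_eq)
  moreover have "\<lfloor>real n / 3\<rfloor> \<le> \<lfloor>(real n - 1) / 2\<rfloor>"
  proof -
    define p where "p = \<lfloor>(real n - 1) / 2\<rfloor>"
    have "(real n - 1) / 2 \<ge> 0" using that by simp
    then have "p \<ge> 0" unfolding p_def by simp
    moreover have "(real n - 1) / 2 < real_of_int p + 1" unfolding p_def by simp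
    then have "real_of_int (int n) < real_of_int (2 * p + 3)" by simp
    then have "int n < 2 * p + 3" by (simp only: of_int_less_iff)
    ultimately have "int n < 3 * (p + 1)" by simp
    then have "real_of_int (int n) < real_of_int (3 * (p + 1))" by (simp only: of_int_less_iff)
    then have "real n / 3 < real_of_int (p + 1)" by simp
    then have "\<lfloor>real n / 3\<rfloor> < p + 1" by (simp only: floor_less_iff)
    then show ?thesis unfolding p_def by simp
  qed
  ultimately show ?thesis unfolding d_def by simp
qed

definition strongly_bounded :: "nat \<Rightarrow> nat set \<Rightarrow> bool" where
  "strongly_bounded n A \<longleftrightarrow> A \<subseteq> {x. real n / 4 < real x \<and> real x < real n / 2}"

end

theory Submission
  imports Defs
begin

text \<open>Suppose some \<open>a \<in> A\<close> satisfies \<open>a \<le> n/4\<close>. Minimality makes the elements of \<open>A\<close> distinct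
  modulo \<open>a\<close>. If \<open>x, y \<in> A\<close> had \<open>x + y \<equiv> n\<close> modulo \<open>a\<close>, then, as \<open>x + y < n\<close>, adding copies of \<open>a\<close>
  would put \<open>n\<close> into the semigroup. So the residues of \<open>A\<close> and those of \<open>n - A\<close> are disjoint, whence
  \<open>2|A| \<le> a \<le> n/4\<close>; for even \<open>n\<close> the residue of \<open>n/2\<close> is missed as well. Since \<open>d\<^sub>n\<close> is about
  \<open>n/6\<close>, this is incompatible with \<open>|A| = d\<^sub>n - k\<close> for large \<open>n\<close>.\<close>

lemma generated_base: "x \<in> A \<Longrightarrow> x \<in> generated A"
  unfolding generated_def by (rule hull_inc)

lemma generated_add: "x \<in> generated A \<Longrightarrow> y \<in> generated A \<Longrightarrow> x + y \<in> generated A"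
  using numerical_semigroup_generated[of A] unfolding numerical_semigroup_def by blast

lemma generated_mult: "x \<in> generated A \<Longrightarrow> j * x \<in> generated A"
proof (induction j)
  case 0
  then show ?case
    using numerical_semigroup_generated[of A] unfolding numerical_semigroup_def by simp
next
  case (Suc j)
  then show ?case by (simp add: generated_add)
qed

text \<open>This puts minimality into usable form: a generator expressible through the others
  contradicts \<open>works_for\<close>.\<close>

lemma generated_Diff_redundant:
  assumes "x \<in> generated (A - {x})"
  shows "generated (A - {x}) = generated A"
proof
  show "generated (A - {x}) \<subseteq> generated A"
    unfolding generated_def by (rule hull_mono) blast
  have "y \<in> generated (A - {x})" if "y \<in> A" for y
    using assms that by (cases "y = x") (simp_all add: generated_base)
  then have "A \<subseteq> generated (A - {x})"
    by (rule subsetI)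
  then show "generated A \<subseteq> generated (A - {x})"
    unfolding generated_def[of A]
    by (rule hull_minimal) (rule numerical_semigroup_generated)
qed

lemma cong_le_imp_generated:
  assumes "[x = y] (mod a)" "x \<le> y" "x \<in> generated A" "a \<in> A"
  shows "y \<in> generated A"
proof -
  obtain j where "y = j * a + x"
    using cong_le_nat[OF assms(2), of a] cong_sym[OF assms(1)] by blast
  then show ?thesis
    using assms(3,4) by (simp add: generated_add generated_mult generated_base)
qed

lemma works_for_bounds:
  assumes "works_for A n" "x \<in> A"
  shows "0 < x" "2 * x < n"
proof -
  have "1 \<le> x" "real x < real n / 2"
    using assms unfolding works_for_def by auto
  then show "0 < x" "2 * x < n"
    by simp_all
qed

lemma works_for_inj_on_mod:
  assumes A: "works_for A n" and a: "a \<in> A"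
  shows "inj_on (\<lambda>x. x mod a) A"
proof (rule linorder_inj_onI)
  fix x y assume xy: "x < y" "x \<in> A" "y \<in> A"
  show "x mod a \<noteq> y mod a"
  proof
    assume eq: "x mod a = y mod a"
    \<comment> \<open>\<open>a\<close> must remain available once \<open>y\<close> is removed. If
      \<open>y = a\<close>, then \<open>a\<close> would divide \<open>x\<close>, although 0 < x <
      a.\<close>
    have "y \<noteq> a"
      using eq xy works_for_bounds(1)[OF A xy(2)] by auto
    then have "y \<in> generated (A - {y})"
      using eq xy a
      by (intro cong_le_imp_generated[of x y a]) (simp_all add: cong_def generated_base)
    then show False
      using generated_Diff_redundant A xy(3) unfolding works_for_def by blast
  qed
qed auto

lemma works_for_add_not_cong:
  assumes A: "works_for A n" and "a \<in> A" "x \<in> A" "y \<in> A"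
  shows "\<not> [x + y = n] (mod a)"
proof
  assume "[x + y = n] (mod a)"
  moreover have "x + y \<le> n"
    using works_for_bounds(2)[OF A assms(3)] works_for_bounds(2)[OF A assms(4)] by linarith
  ultimately have "n \<in> generated A"
    using cong_le_imp_generated assms generated_add generated_base by metis
  then show False
    using A unfolding works_for_def by blast
qed

lemma works_for_card_le:
  assumes A: "works_for A n" and a: "a \<in> A"
  shows "2 * card A \<le> a" and "even n \<Longrightarrow> 2 * card A < a"
proof -
  have lt: "x < n" if "x \<in> A" for x
    using works_for_bounds(2)[OF A that] by linarith
  have a0: "0 < a"
    using works_for_bounds(1)[OF A a] .
  let ?R = "(\<lambda>x. x mod a) ` A" and ?S = "(\<lambda>x. (n - x) mod a) ` A"
  \<comment> \<open>As x < n, the subtraction is not truncated, so x can be cancelled from x + z and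
    x + (n - x). Forbidden sums thus become coincidences of residues between \<open>A\<close> and
    its reflection.\<close>
  have reflect: "[x + z = n] (mod a) \<longleftrightarrow> z mod a = (n - x) mod a" if "x \<in> A" for x z
    using lt[OF that] cong_add_lcancel_nat[of x z "n - x" a] by (simp add: cong_def)
  have "inj_on (\<lambda>x. (n - x) mod a) A"
  proof (rule inj_onI)
    fix x y assume xy: "x \<in> A" "y \<in> A" "(n - x) mod a = (n - y) mod a"
    then have "[x + (n - y) = y + (n - y)] (mod a)"
      using reflect[of x "n - y"] lt[of y] by simp
    then have "[x = y] (mod a)"
      by (simp only: cong_add_rcancel_nat)
    then show "x = y"
      using works_for_inj_on_mod[OF A a] xy by (auto simp: cong_def inj_on_def)
  qed
  then have S: "card ?S = card A"
    by (rule card_image)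
  have R: "card ?R = card A"
    using works_for_inj_on_mod[OF A a] by (rule card_image)
  have fin: "finite A"
    using lt by (meson finite_nat_set_iff_bounded)
  have disj: "?R \<inter> ?S = {}"
    using reflect works_for_add_not_cong[OF A a] by force
  then have card: "card (?R \<union> ?S) = 2 * card A"
    using R S fin by (simp add: card_Un_disjoint)
  have sub: "?R \<union> ?S \<subseteq> {..<a}"
    using a0 by auto
  show "2 * card A \<le> a"
    using card_mono[OF _ sub] card by simp
  show "2 * card A < a" if "even n"
  proof -
    have half: "n div 2 + n div 2 = n"
      using that by auto
    \<comment> \<open>This is the forbidden sum with both summands equal to x.\<close>
    have notR: "x mod a \<noteq> (n div 2) mod a" if "x \<in> A" for x
    proof
      assume "x mod a = (n div 2) mod a"
      then have "[x + x = n div 2 + n div 2] (mod a)"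
        unfolding cong_def by (metis mod_add_eq)
      then show False
        using works_for_add_not_cong[OF A a that that] half by simp
    qed
    \<comment> \<open>The reflection x \<mapsto> n - x fixes n/2, so meeting this residue from the
      reflected side would mean meeting it from \<open>A\<close> as well.\<close>
    have "(n div 2) mod a \<noteq> (n - x) mod a" if "x \<in> A" for x
    proof
      assume "(n div 2) mod a = (n - x) mod a"
      then have "[x + n div 2 = n div 2 + n div 2] (mod a)"
        using reflect[OF that] half by simp
      then have "[x = n div 2] (mod a)"
        by (simp only: cong_add_rcancel_nat)
      then show False
        using notR[OF that] by (simp add: cong_def)
    qed
    then have "(n div 2) mod a \<notin> ?R \<union> ?S"
      using notR by fastforce
    moreover have "(n div 2) mod a \<in> {..<a}"
      using a0 by simp
    ultimately have "?R \<union> ?S \<noteq> {..<a}"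
      by metis
    then have "?R \<union> ?S \<subset> {..<a}"
      using sub by (simp only: psubset_eq simp_thms)
    then show ?thesis
      using psubset_card_mono[of "{..<a}" "?R \<union> ?S"] card by simp
  qed
qed

lemma d_eq_div: "n \<ge> 1 \<Longrightarrow> int (d n) = (int n - 1) div 2 - int n div 3"
  using d_eq_floor[of n] floor_divide_of_int_eq[of "int n - 1" 2, where ?'a = real]
    floor_divide_of_int_eq[of "int n" 3, where ?'a = real] by simp

theorem theorem16:
  fixes k n b :: nat
  assumes "n \<ge> 1"
    and "b \<in> {0, 1, 2}"
    and "[n = b] (mod 3)"
    and "int n > 24 * int k + 12 - 8 * int b"
  shows "\<forall>A. works_for A n \<and> int (card A) = int (d n) - int k \<longrightarrow> strongly_bounded n A"
proof (intro allI impI)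
  fix A assume "works_for A n \<and> int (card A) = int (d n) - int k"
  then have A: "works_for A n" and card: "int (card A) = int (d n) - int k"
    by auto
  have b: "n mod 3 = b"
    using assms(2,3) by (auto simp: cong_def)
  have "n < 4 * a" if a: "a \<in> A" for a
  proof (rule ccontr)
    assume "\<not> n < 4 * a"
    then have a4: "4 * a \<le> n" by simp
    define m where "m = n div 3"
    have n: "n = 3 * m + b"
      using b unfolding m_def by presburger
    have m: "int n div 3 = int m"
      unfolding m_def by (simp add: zdiv_int)
    \<comment> \<open>Both parities give the same bound. From 8|A| + 4 \<le> 4a \<le> n with |A| = h
      - 1 - m - k (even), or 8|A| \<le> 4a \<le> n with |A| = h - m - k (odd), one gets 4n - 4 - 8m
      - 8k \<le> n. Substituting 3m = n - b yields n \<le> 24k + 12 - 8b, the exact negation of the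
      hypothesis. The strict inequality for even n makes up for \<open>d n\<close> having h - 1 in
      place of h.\<close>
    show False
    proof (cases "even n")
      case True
      then obtain h where h: "n = 2 * h" by blast
      have "(int n - 1) div 2 = int h - 1"
        using h by presburger
      then show False
        using works_for_card_le(2)[OF A a True] card d_eq_div[OF assms(1)] m n h a4 assms(4)
        by linarith
    next
      case False
      then obtain h where h: "n = 2 * h + 1" by (blast elim: oddE)
      then have "(int n - 1) div 2 = int h"
        by simp
      then show False
        using works_for_card_le(1)[OF A a] card d_eq_div[OF assms(1)] m n h a4 assms(4)
        by linarith
    qed
  qed
  then show "strongly_bounded n A"
    using works_for_bounds(2)[OF A] unfolding strongly_bounded_def by fastforce
qed

end
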